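(* Let $G$ be a graph and let $k\ge 1$ be an integer. A set $S\subseteq V(G)$ is a signed $k$-dominating set if and only if $S$ is a global $(\{d\in\mathbb{Z} : d\geq k-1\},\{o\in\mathbb{Z} : o\geq k+1\})$-alliance.
   Context: Graphs are finite and simple. For a graph $G=(V,E)$, $S\subseteq V$ and $v\in V$, $N_S(v)$ is the set of neighbors of $v$ lying in $S$, $\delta_S(v)=|N_S(v)|$, $\overline{S}=V\setminus S$, $N[v]=N_V(v)\cup\{v\}$ is the closed neighborhood, $N(S)=\bigcup_{u\in S}N_V(u)$ and $N[S]=N(S)\cup S$. A set $S$ is dominating if $N[S]=V$. For $D,O\subseteq\mathbb{Z}$, a $(D,O)$-alliance in $G$ is a vertex set $S$ such that (1) $\delta_S(v)-\delta_{\overline{S}}(v)\in D$ for all $v\in S$, and (2) $\delta_S(v)-\delta_{\overline{S}}(v)\in O$ for all $v\in N(S)\setminus S$. It is called global if $S$ is also a dominating set. A signed $k$-dominating function is a function $f:V\to\{-1,+1\}$ with $f(N[v])\ge k$ for every $v\in V$, where $f(T)=\sum_{u\in T}f(u)$ for $T\subseteq V$. The signed $k$-dominating set associated to $f$ is the set of vertices assigned the value $+1$ by $f$; a set is a signed $k$-dominating set if it is associated to some signed $k$-dominating function. *)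

theory Defs
  imports "Graph_Theory.Digraph" "HOL-Library.FuncSet"
begin

text \<open>
  A finite simple graph is an instance of the locale \<^locale>\<open>graph\<close>: a finite digraph without
  loops or parallel arcs whose arc relation is symmetric, so that an undirected edge is a pair of
  opposite arcs. Two vertices are adjacent iff one dominates the other in the sense of
  \<open>u \<rightarrow>\<^bsub>G\<^esub> v\<close>; this is unrelated to dominating sets.
\<close>

definition neighbors_in :: "('a, 'b) pre_digraph \<Rightarrow> 'a set \<Rightarrow> 'a \<Rightarrow> 'a set" where
  "neighbors_in G S v = {u \<in> S. v \<rightarrow>\<^bsub>G\<^esub> u}"

definition degree_in :: "('a, 'b) pre_digraph \<Rightarrow> 'a set \<Rightarrow> 'a \<Rightarrow> nat" where
  "degree_in G S v = card (neighbors_in G S v)"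

definition closed_neighborhood :: "('a, 'b) pre_digraph \<Rightarrow> 'a \<Rightarrow> 'a set" where
  "closed_neighborhood G v = neighbors_in G (verts G) v \<union> {v}"

definition set_neighborhood :: "('a, 'b) pre_digraph \<Rightarrow> 'a set \<Rightarrow> 'a set" where
  "set_neighborhood G S = (\<Union>u\<in>S. neighbors_in G (verts G) u)"

definition closed_set_neighborhood :: "('a, 'b) pre_digraph \<Rightarrow> 'a set \<Rightarrow> 'a set" where
  "closed_set_neighborhood G S = set_neighborhood G S \<union> S"

definition dominating_set :: "('a, 'b) pre_digraph \<Rightarrow> 'a set \<Rightarrow> bool" where
  "dominating_set G S \<longleftrightarrow> S \<subseteq> verts G \<and> closed_set_neighborhood G S = verts G"

definition alliance :: "int set \<Rightarrow> int set \<Rightarrow> ('a, 'b) pre_digraph \<Rightarrow> 'a set \<Rightarrow> bool" where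
  "alliance D O' G S \<longleftrightarrow>
     S \<subseteq> verts G \<and>
     (\<forall>v\<in>S. int (degree_in G S v) - int (degree_in G (verts G - S) v) \<in> D) \<and>
     (\<forall>v\<in>set_neighborhood G S - S.
        int (degree_in G S v) - int (degree_in G (verts G - S) v) \<in> O')"

definition global_alliance :: "int set \<Rightarrow> int set \<Rightarrow> ('a, 'b) pre_digraph \<Rightarrow> 'a set \<Rightarrow> bool" where
  "global_alliance D O' G S \<longleftrightarrow> alliance D O' G S \<and> dominating_set G S"

text \<open>Functions on \<^term>\<open>verts G\<close> are total on the type; values outside \<^term>\<open>verts G\<close> play no role.\<close>

definition signed_dominating_function ::
    "int \<Rightarrow> ('a, 'b) pre_digraph \<Rightarrow> ('a \<Rightarrow> int) \<Rightarrow> bool" where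
  "signed_dominating_function k G f \<longleftrightarrow>
     f \<in> verts G \<rightarrow> {-1, 1} \<and>
     (\<forall>v\<in>verts G. k \<le> (\<Sum>u\<in>closed_neighborhood G v. f u))"

definition associated_set :: "('a, 'b) pre_digraph \<Rightarrow> ('a \<Rightarrow> int) \<Rightarrow> 'a set" where
  "associated_set G f = {v \<in> verts G. f v = 1}"

definition signed_dominating_set :: "int \<Rightarrow> ('a, 'b) pre_digraph \<Rightarrow> 'a set \<Rightarrow> bool" where
  "signed_dominating_set k G S \<longleftrightarrow>
     (\<exists>f. signed_dominating_function k G f \<and> S = associated_set G f)"

end

theory Submission
  imports Defs
begin

text \<open>
  If \<open>f\<close> is the \<open>\<plusminus>1\<close>-valued function with associated set \<open>S\<close>, then
  \<open>f(N[v])\<close> equals \<open>\<delta>\<^sub>S(v) - \<delta>\<^bsub>V - S\<^esub>(v) + f(v)\<close>, because \<open>v\<close> is not a neighbor of itself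
  (\<open>sum_closed_neighborhood\<close>). Hence \<open>f(N[v]) \<ge> k\<close> says that the degree difference is at least
  \<open>k - 1\<close> if \<open>v \<in> S\<close>, and at least \<open>k + 1\<close> if \<open>v \<notin> S\<close>
  (\<open>signed_dominating_set_iff_degrees\<close>). A global alliance imposes the second condition on
  \<open>N(S) - S\<close> only, but this is all of \<open>V - S\<close> as \<open>S\<close> is dominating. Conversely, as \<open>k + 1 > 0\<close>,
  a vertex outside \<open>S\<close> satisfying the second condition has a neighbor in \<open>S\<close>, so \<open>S\<close> is
  dominating.
\<close>

lemma (in graph) mem_set_neighborhood_iff:
  assumes "S \<subseteq> verts G"
  shows "v \<in> set_neighborhood G S \<longleftrightarrow> neighbors_in G S v \<noteq> {}"
proof -
  have "u \<rightarrow>\<^bsub>G\<^esub> v \<longleftrightarrow> v \<rightarrow>\<^bsub>G\<^esub> u" for u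
    using sym_arcs by (auto simp: symmetric_def elim: symE)
  moreover have "v \<in> verts G" if "u \<rightarrow>\<^bsub>G\<^esub> v" for u
    using that by (rule adj_in_verts)
  ultimately show ?thesis
    by (auto simp: set_neighborhood_def neighbors_in_def)
qed

lemma (in graph) sum_closed_neighborhood:
  fixes f :: "'a \<Rightarrow> int"
  assumes f: "f \<in> verts G \<rightarrow> {-1, 1}"
    and S: "S = associated_set G f"
  shows "(\<Sum>u\<in>closed_neighborhood G v. f u) =
    int (degree_in G S v) - int (degree_in G (verts G - S) v) + f v"
proof -
  let ?A = "neighbors_in G S v" and ?B = "neighbors_in G (verts G - S) v"
  have fin: "finite ?A" "finite ?B"
    by (auto simp: S associated_set_def neighbors_in_def)
  have "v \<notin> ?A \<union> ?B"
    using adj_not_same by (auto simp: neighbors_in_def)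
  moreover have "closed_neighborhood G v = insert v (?A \<union> ?B)"
    by (auto simp: closed_neighborhood_def neighbors_in_def S associated_set_def)
  ultimately have "(\<Sum>u\<in>closed_neighborhood G v. f u) = f v + (\<Sum>u\<in>?A \<union> ?B. f u)"
    using fin by simp
  also have "(\<Sum>u\<in>?A \<union> ?B. f u) = (\<Sum>u\<in>?A. f u) + (\<Sum>u\<in>?B. f u)"
    using fin by (intro sum.union_disjoint) (auto simp: neighbors_in_def)
  also have "(\<Sum>u\<in>?A. f u) = (\<Sum>u\<in>?A. 1)"
    by (intro sum.cong) (auto simp: neighbors_in_def S associated_set_def)
  also have "(\<Sum>u\<in>?B. f u) = (\<Sum>u\<in>?B. -1)"
    using f by (intro sum.cong) (auto simp: neighbors_in_def S associated_set_def)
  finally show ?thesis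
    by (simp add: degree_in_def)
qed

lemma (in graph) signed_dominating_set_iff_degrees:
  assumes "S \<subseteq> verts G"
  shows "signed_dominating_set k G S \<longleftrightarrow>
    (\<forall>v\<in>verts G. (if v \<in> S then k - 1 else k + 1) \<le>
       int (degree_in G S v) - int (degree_in G (verts G - S) v))"
    (is "_ \<longleftrightarrow> ?R")
proof -
  have iff: "signed_dominating_function k G f \<longleftrightarrow> ?R"
    if f: "f \<in> verts G \<rightarrow> {-1, 1}" and S: "S = associated_set G f" for f
  proof -
    have "k \<le> (\<Sum>u\<in>closed_neighborhood G v. f u) \<longleftrightarrow>
        (if v \<in> S then k - 1 else k + 1) \<le>
          int (degree_in G S v) - int (degree_in G (verts G - S) v)"
      if "v \<in> verts G" for v
    proof -
      have "f v = (if v \<in> S then 1 else -1)"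
        using f S that by (auto simp: associated_set_def)
      then show ?thesis
        unfolding sum_closed_neighborhood[OF f S] by auto
    qed
    then show ?thesis
      using f by (simp add: signed_dominating_function_def)
  qed
  show ?thesis
  proof
    assume "signed_dominating_set k G S"
    then show ?R
      using iff by (auto simp only: signed_dominating_set_def signed_dominating_function_def)
  next
    assume R: ?R
    define f :: "'a \<Rightarrow> int" where "f v = (if v \<in> S then 1 else -1)" for v
    have "f \<in> verts G \<rightarrow> {-1, 1}" and "S = associated_set G f"
      using assms by (auto simp: f_def associated_set_def)
    then show "signed_dominating_set k G S"
      using iff R by (auto simp only: signed_dominating_set_def)
  qed
qed

theorem proposition3:
  fixes G :: "('a, 'b) pre_digraph" and k :: int and S :: "'a set"
  assumes "graph G"
    and "k \<ge> 1"
    and "S \<subseteq> verts G"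
  shows "signed_dominating_set k G S \<longleftrightarrow>
    global_alliance {d. d \<ge> k - 1} {o'. o' \<ge> k + 1} G S"
proof -
  interpret graph G by fact
  let ?d = "\<lambda>v. int (degree_in G S v) - int (degree_in G (verts G - S) v)"
  have sub: "set_neighborhood G S \<subseteq> verts G"
    by (auto simp: set_neighborhood_def neighbors_in_def)
  have dom: "dominating_set G S \<longleftrightarrow> verts G - S \<subseteq> set_neighborhood G S"
    using sub assms(3) by (auto simp: dominating_set_def closed_set_neighborhood_def)
  have nbr: "v \<in> set_neighborhood G S" if "k + 1 \<le> ?d v" for v
  proof -
    have "degree_in G S v \<noteq> 0"
      using that assms(2) by linarith
    then show ?thesis
      using mem_set_neighborhood_iff[OF assms(3)] by (auto simp: degree_in_def)
  qed
  have "signed_dominating_set k G S \<longleftrightarrow>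
      (\<forall>v\<in>S. k - 1 \<le> ?d v) \<and> (\<forall>v\<in>verts G - S. k + 1 \<le> ?d v)"
    using assms(3) by (auto simp: signed_dominating_set_iff_degrees)
  also have "\<dots> \<longleftrightarrow> (\<forall>v\<in>S. k - 1 \<le> ?d v) \<and>
      (\<forall>v\<in>set_neighborhood G S - S. k + 1 \<le> ?d v) \<and> verts G - S \<subseteq> set_neighborhood G S"
    using nbr sub by blast
  also have "\<dots> \<longleftrightarrow> global_alliance {d. d \<ge> k - 1} {o'. o' \<ge> k + 1} G S"
    using assms(3) by (simp add: global_alliance_def alliance_def dom)
  finally show ?thesis .
qed

end
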